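(* There exists a sequence of non-singular graphs $G_m$ ($m\in\mathbb{N}$) with $n^-(G_m)\to\infty$ as $m\to\infty$ such that \[ n^+(G_m)=\Theta\left(n^-(G_m)^{7/3}\right)\quad\text{as } m\to\infty.\]
   Context: Graphs are finite, simple and undirected. For a graph $G$ with adjacency matrix $A(G)$, $n^+(G)$, $n^0(G)$, $n^-(G)$ denote the number of positive, zero and negative eigenvalues of $A(G)$, respectively, counted with multiplicity. A graph $G$ is non-singular if $A(G)$ is non-singular, i.e. $n^0(G)=0$. For positive sequences, $f(m)=\Theta(g(m))$ as $m\to\infty$ means that there are constants $c,C>0$ with $c\,g(m)\le f(m)\le C\,g(m)$ for all sufficiently large $m$. *)

theory Defs
  imports
    "Graph_Theory.Pair_Digraph"
    "Jordan_Normal_Form.Char_Poly"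
    "HOL-Library.Landau_Symbols"
begin

text \<open>
  Finite simple undirected graphs are the digraphs satisfying \<^locale>\<open>pair_graph\<close>: finite vertex
  and arc sets, no loops, and a symmetric arc relation, so that an undirected edge is represented
  by its two orientations.

  The adjacency matrix is indexed by the positions of the vertices in increasing order.  The
  ordering of the vertices does not affect any of the notions below, all of which are invariant
  under simultaneous permutation of rows and columns.
\<close>

definition adjacency_matrix :: "'a::linorder pair_pre_digraph \<Rightarrow> real mat" where
  "adjacency_matrix G =
     (let vs = sorted_list_of_set (pverts G)
      in mat (length vs) (length vs)
           (\<lambda>(i, j). if (vs ! i, vs ! j) \<in> parcs G then 1 else 0))"

text \<open>
  Multiplicity is algebraic; for the symmetric matrices considered here it equals the
  geometric one, and all complex eigenvalues are real.
\<close>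

definition eigenvalue_count :: "real mat \<Rightarrow> (real \<Rightarrow> bool) \<Rightarrow> nat" where
  "eigenvalue_count A P = (\<Sum>k | eigenvalue A k \<and> P k. Polynomial.order k (char_poly A))"

definition n_pos :: "'a::linorder pair_pre_digraph \<Rightarrow> nat" where
  "n_pos G = eigenvalue_count (adjacency_matrix G) (\<lambda>k. k > 0)"

definition n_zero :: "'a::linorder pair_pre_digraph \<Rightarrow> nat" where
  "n_zero G = eigenvalue_count (adjacency_matrix G) (\<lambda>k. k = 0)"

definition n_neg :: "'a::linorder pair_pre_digraph \<Rightarrow> nat" where
  "n_neg G = eigenvalue_count (adjacency_matrix G) (\<lambda>k. k < 0)"

definition nonsingular_graph :: "'a::linorder pair_pre_digraph \<Rightarrow> bool" where
  "nonsingular_graph G \<longleftrightarrow> invertible_mat (adjacency_matrix G)"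

lemma adjacency_matrix_carrier:
  "adjacency_matrix G \<in> carrier_mat (card (pverts G)) (card (pverts G))"
  by (simp add: adjacency_matrix_def Let_def)

lemma nonsingular_graph_iff: "nonsingular_graph G \<longleftrightarrow> n_zero G = 0"
proof -
  define A where "A = adjacency_matrix G"
  define n where "n = card (pverts G)"
  have A: "A \<in> carrier_mat n n"
    unfolding A_def n_def by (rule adjacency_matrix_carrier)
  have "nonsingular_graph G \<longleftrightarrow> det A \<noteq> 0"
  proof
    assume "nonsingular_graph G"
    then obtain B where B: "A * B = 1\<^sub>m n" "B * A = 1\<^sub>m (dim_row B)"
      using A unfolding nonsingular_graph_def A_def[symmetric] invertible_mat_def inverts_mat_def
      by auto
    have "dim_col (A * B) = n" "dim_col (B * A) = dim_row B"
      by (simp_all only: B index_one_mat)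
    hence "B \<in> carrier_mat n n"
      using A by auto
    hence "det A * det B = 1"
      using det_mult[OF A, of B] B(1) by simp
    thus "det A \<noteq> 0" by auto
  next
    assume "det A \<noteq> 0"
    from det_non_zero_imp_unit[OF A this, of undefined]
    show "nonsingular_graph G"
      using A unfolding nonsingular_graph_def A_def[symmetric] invertible_mat_def inverts_mat_def
      by (auto simp: Units_def ring_mat_def)
  qed
  also have "\<dots> \<longleftrightarrow> poly (char_poly A) 0 \<noteq> 0"
  proof -
    have "char_matrix A 0 = A"
      using A by (auto simp: char_matrix_def)
    thus ?thesis
      using eigenvalue_det[OF A, of 0] eigenvalue_root_char_poly[OF A, of 0] by simp
  qed
  also have "\<dots> \<longleftrightarrow> n_zero G = 0"
  proof -
    have "char_poly A \<noteq> 0"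
      using degree_monic_char_poly[OF A] by auto
    hence "Polynomial.order 0 (char_poly A) = 0 \<longleftrightarrow> poly (char_poly A) 0 \<noteq> 0"
      by (simp add: order_root)
    moreover have "{k. eigenvalue A k \<and> k = 0} =
        (if poly (char_poly A) 0 = 0 then {0} else {})"
      using eigenvalue_root_char_poly[OF A] by auto
    ultimately show ?thesis
      by (simp add: n_zero_def eigenvalue_count_def flip: A_def)
  qed
  finally show ?thesis .
qed

end

theory Submission
  imports Defs
begin

text \<open>
  Let the vertices be the tuples in \<open>[t\<^sup>2] \<times> [t]\<^sup>5\<close>, with sides \<open>n\<^sub>i\<close>, and let adjacency of \<open>x\<close> and \<open>z\<close> depend only on
  their agreement set \<open>T = {i. x\<^sub>i = z\<^sub>i}\<close> through some \<open>f(T) = \<Sum>\<^bsub>S \<subseteq> T\<^esub> c\<^sub>S\<close>. The adjacency matrix is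
  then a combination of tensor products of identity and all-ones matrices, and a tensor product of
  eigenvectors of the all-ones matrices, nonconstant exactly in the coordinates \<open>U\<close>, has eigenvalue
  \<open>\<Sum>\<^bsub>S \<supseteq> U\<^esub> c\<^sub>S \<Prod>\<^bsub>i \<notin> S\<^esub> n\<^sub>i\<close>. This can be negative only if \<open>U\<close> is contained in some \<open>S\<close> with
  \<open>c\<^sub>S < 0\<close>. If all such \<open>S\<close> have \<open>\<Prod>\<^bsub>i \<in> S\<^esub> n\<^sub>i = t\<^sup>3\<close>, there are \<open>O(t\<^sup>3)\<close> negative eigenvalues
  among \<open>t\<^sup>7\<close>. If the full set has coefficient 1, every eigenvalue is 1 modulo \<open>t\<close>, hence nonzero.
\<close>

section \<open>Eigenvalue counts from an eigenbasis\<close>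

lemma order_prod_linear:
  fixes d :: "nat \<Rightarrow> real"
  assumes "finite I"
  shows "Polynomial.order a (\<Prod>k\<in>I. [:- d k, 1:]) = card {k\<in>I. d k = a}"
  using assms
proof (induction I)
  case empty
  then show ?case by (simp add: order_0I)
next
  case (insert k I)
  have "Polynomial.order a [:- d k, 1:] = (if d k = a then 1 else 0)"
    using order_power_n_n[of a 1] by (auto simp: order_0I)
  moreover have "{j \<in> insert k I. d j = a} =
      (if d k = a then insert k {j\<in>I. d j = a} else {j\<in>I. d j = a})"
    by auto
  moreover have "(\<Prod>k\<in>insert k I. [:- d k, 1:]) \<noteq> 0"
    using insert.hyps by (subst prod_zero_iff) auto
  ultimately show ?case
    using insert by (simp add: order_mult del: mult_pCons_left)
qed

text \<open>The columns of \<open>P\<close> form an eigenbasis, so \<open>A\<close> is similar to a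
  diagonal matrix and its characteristic polynomial splits. The algebraic multiplicity of a root is
  then the size of its fibre under \<open>d\<close>, and the fibres partition the index set.\<close>

lemma eigenvalue_count_eigenbasis:
  fixes A :: "real mat" and d :: "nat \<Rightarrow> real"
  assumes A: "A \<in> carrier_mat N N" and P: "P \<in> carrier_mat N N" and Q: "Q \<in> carrier_mat N N"
    and QP: "Q * P = 1\<^sub>m N"
    and AP: "A * P = P * mat N N (\<lambda>(i, j). if i = j then d i else 0)"
  shows "eigenvalue_count A p = card {k\<in>{..<N}. p (d k)}"
proof -
  define D where "D = mat N N (\<lambda>(i, j). if i = j then d i else 0)"
  have D: "D \<in> carrier_mat N N" by (simp add: D_def)
  have PQ: "P * Q = 1\<^sub>m N"
    by (rule mat_mult_left_right_inverse[OF Q P QP])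
  have "A = A * (P * Q)" using A PQ by simp
  also have "\<dots> = P * D * Q"
    using A P Q D AP by (simp add: assoc_mult_mat[symmetric] D_def)
  finally have "similar_mat A D"
    using A P Q D PQ QP by (intro similar_matI[of _ _ P Q N]) auto
  hence "char_poly A = (\<Prod>a\<leftarrow>diag_mat D. [:- a, 1:])"
    by (subst char_poly_similar, assumption)
       (intro char_poly_upper_triangular[OF D], auto simp: upper_triangular_def D_def)
  also have "\<dots> = (\<Prod>k<N. [:- d k, 1:])"
    by (simp add: diag_mat_def D_def o_def 
        prod.distinct_set_conv_list[symmetric] atLeast0LessThan cong: map_cong)
  finally have cp: "char_poly A = (\<Prod>k<N. [:- d k, 1:])" .
  have ev: "eigenvalue A a \<longleftrightarrow> a \<in> d ` {..<N}" for a
    using eigenvalue_root_char_poly[OF A, of a] by (auto simp: cp poly_prod)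
  have "eigenvalue_count A p = (\<Sum>a\<in>{a\<in>d ` {..<N}. p a}. card {k\<in>{..<N}. d k = a})"
    unfolding eigenvalue_count_def ev cp by (simp add: order_prod_linear)
  also have "\<dots> = card (\<Union>a\<in>{a\<in>d ` {..<N}. p a}. {k\<in>{..<N}. d k = a})"
    by (rule card_UN_disjoint[symmetric]) auto
  also have "(\<Union>a\<in>{a\<in>d ` {..<N}. p a}. {k\<in>{..<N}. d k = a}) = {k\<in>{..<N}. p (d k)}"
    by auto
  finally show ?thesis .
qed

section \<open>Matrices depending on the agreement set of two tuples\<close>

text \<open>The list holds the Moebius coefficients of the weight. A list of terms, rather than a
  function on sets, permits induction over the terms and direct evaluation for a concrete
  list.\<close>

definition agreement_weight :: "(int \<times> 'i set) list \<Rightarrow> 'i set \<Rightarrow> int" where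
  "agreement_weight cs T = (\<Sum>(c, S)\<leftarrow>cs. c * of_bool (S \<subseteq> T))"

definition agreement_eigenvalue ::
    "'i set \<Rightarrow> ('i \<Rightarrow> nat) \<Rightarrow> (int \<times> 'i set) list \<Rightarrow> 'i set \<Rightarrow> int" where
  "agreement_eigenvalue K n cs U =
     (\<Sum>(c, S)\<leftarrow>cs. c * of_bool (U \<subseteq> S) * (\<Prod>i\<in>K - S. int (n i)))"

text \<open>
  The all-ones vector and the differences of unit vectors \<open>e\<^sub>b - e\<^sub>0\<close> diagonalise the all-ones
  matrix; the dual vectors are the rows of the inverse of this basis.
\<close>

definition basis_vec :: "nat \<Rightarrow> nat \<Rightarrow> real" where
  "basis_vec b a = (if b = 0 then 1 else of_bool (a = b) - of_bool (a = 0))"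

definition dual_vec :: "nat \<Rightarrow> nat \<Rightarrow> nat \<Rightarrow> real" where
  "dual_vec n b a = (if b = 0 then 0 else of_bool (a = b)) + (if b = 0 then 1 else - 1) / real n"

lemma sum_basis_vec:
  assumes "b < n"
  shows "(\<Sum>a<n. basis_vec b a) = (if b = 0 then real n else 0)"
proof -
  have "(\<Sum>a<n. of_bool (a = c)) = (1 :: real)" if "c < n" for c
    using that by (simp add: of_bool_def)
  thus ?thesis
    using assms by (cases "b = 0") (simp_all add: basis_vec_def sum_subtractf)
qed

lemma sum_dual_basis_vec:
  assumes "b < n" "c < n"
  shows "(\<Sum>a<n. dual_vec n b a * basis_vec c a) = of_bool (b = c)"
proof -
  \<comment> \<open>A dual vector is a unit vector (or 0) plus a multiple of the all-ones vector, so
    the second part needs only the entry sum of \<open>basis_vec c\<close>.\<close>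
  have "(\<Sum>a<n. dual_vec n b a * basis_vec c a) =
      (\<Sum>a<n. if a = b then (if b = 0 then 0 else basis_vec c b) else 0)
        + (if b = 0 then 1 else - 1) / real n * (\<Sum>a<n. basis_vec c a)"
    by (simp add: dual_vec_def ring_distribs sum.distrib sum_distrib_left of_bool_def
        if_distrib[of "\<lambda>x. x * _"] cong: if_cong sum.cong)
  also have "\<dots> = of_bool (b = c)"
    unfolding sum_basis_vec[OF assms(2)] using assms by (auto simp: basis_vec_def)
  finally show ?thesis .
qed

text \<open>Tuples index both the entries \<open>x\<close> and the eigenvectors \<open>y\<close>.
  The vector of \<open>y\<close> is nonconstant exactly in the coordinates with \<open>y i\<close>
  nonzero.\<close>

definition tensor_vec :: "'i set \<Rightarrow> ('i \<Rightarrow> nat) \<Rightarrow> ('i \<Rightarrow> nat) \<Rightarrow> real" where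
  "tensor_vec K y x = (\<Prod>i\<in>K. basis_vec (y i) (x i))"

text \<open>The indicator of agreement on \<open>S\<close> is a tensor product of identity matrices
  on \<open>S\<close> and all-ones matrices elsewhere. An all-ones factor multiplies the constant
  vector by \<open>n i\<close> and kills every difference of unit vectors.\<close>

lemma sum_agreement_tensor_vec:
  assumes K: "finite K" and S: "S \<subseteq> K"
    and x: "x \<in> (\<Pi>\<^sub>E i\<in>K. {..<n i})" and y: "y \<in> (\<Pi>\<^sub>E i\<in>K. {..<n i})"
  shows "(\<Sum>z\<in>(\<Pi>\<^sub>E i\<in>K. {..<n i}). of_bool (\<forall>i\<in>S. x i = z i) * tensor_vec K y z) =
           of_bool ({i\<in>K. y i \<noteq> 0} \<subseteq> S) * (\<Prod>i\<in>K - S. real (n i)) * tensor_vec K y x"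
proof -
  have split: "(\<Prod>i\<in>K. if i \<in> S then f i else g i) = prod f S * prod g (K - S)"
    for f g :: "'a \<Rightarrow> real"
  proof -
    have "(\<Prod>i\<in>K. if i \<in> S then f i else g i) = prod f (K \<inter> S) * prod g (K \<inter> - S)"
      using prod.If_cases[OF K, of "\<lambda>i. i \<in> S" f g] by simp
    moreover have "K \<inter> S = S" "K \<inter> - S = K - S" using S by auto
    ultimately show ?thesis by simp
  qed
  have ind: "of_bool (\<forall>i\<in>S. x i = z i) = (\<Prod>i\<in>K. if i \<in> S then of_bool (x i = z i) else (1 :: real))"
    for z
  proof -
    have "of_bool (\<forall>i\<in>S. x i = z i) = (\<Prod>i\<in>S. of_bool (x i = z i) :: real)"
      using finite_subset[OF S K] by (induction S rule: finite_induct) auto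
    thus ?thesis by (simp add: split)
  qed
  have "(\<Sum>z\<in>(\<Pi>\<^sub>E i\<in>K. {..<n i}). of_bool (\<forall>i\<in>S. x i = z i) * tensor_vec K y z) =
      (\<Sum>z\<in>(\<Pi>\<^sub>E i\<in>K. {..<n i}).
        \<Prod>i\<in>K. (if i \<in> S then of_bool (x i = z i) else 1) * basis_vec (y i) (z i))"
    by (simp only: ind tensor_vec_def prod.distrib)
  also have "\<dots> =
      (\<Prod>i\<in>K. \<Sum>a<n i. (if i \<in> S then of_bool (x i = a) else 1) * basis_vec (y i) a)"
    using K by (intro prod_sum_PiE[symmetric]) auto
  \<comment> \<open>Outside \<open>S\<close> the factor \<open>basis_vec (y i) (x i)\<close> can be
    inserted freely: it is 1 if \<open>y i = 0\<close>, and otherwise the whole term is 0. This lets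
    \<open>tensor_vec K y x\<close> be reassembled.\<close>
  also have "\<dots> = (\<Prod>i\<in>K. if i \<in> S then basis_vec (y i) (x i)
                              else of_bool (y i = 0) * real (n i) * basis_vec (y i) (x i))"
  proof (rule prod.cong[OF refl])
    fix i assume i: "i \<in> K"
    have *: "x i < n i" "y i < n i" using x y i by auto
    have "(\<Sum>a<n i. of_bool (x i = a) * basis_vec (y i) a) =
        (\<Sum>a<n i. if x i = a then basis_vec (y i) a else 0)"
      by (intro sum.cong) auto
    thus "(\<Sum>a<n i. (if i \<in> S then of_bool (x i = a) else 1) * basis_vec (y i) a) =
        (if i \<in> S then basis_vec (y i) (x i)
         else of_bool (y i = 0) * real (n i) * basis_vec (y i) (x i))"
      unfolding sum_basis_vec[OF *(2)] using * sum_basis_vec[OF *(2)]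
      by (cases "i \<in> S"; cases "y i = 0") (simp_all add: basis_vec_def[of 0])
  qed
  also have "\<dots> = (\<Prod>i\<in>K - S. of_bool (y i = 0)) * (\<Prod>i\<in>K - S. real (n i)) *
      ((\<Prod>i\<in>S. basis_vec (y i) (x i)) * (\<Prod>i\<in>K - S. basis_vec (y i) (x i)))"
    by (simp add: split prod.distrib)
  also have "(\<Prod>i\<in>S. basis_vec (y i) (x i)) * (\<Prod>i\<in>K - S. basis_vec (y i) (x i)) = tensor_vec K y x"
    using prod.subset_diff[OF S K, of "\<lambda>i. basis_vec (y i) (x i)"]
    by (simp add: tensor_vec_def mult.commute)
  also have "(\<Prod>i\<in>K - S. of_bool (y i = 0)) = (of_bool ({i\<in>K. y i \<noteq> 0} \<subseteq> S) :: real)"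
  proof (cases "{i\<in>K. y i \<noteq> 0} \<subseteq> S")
    case False
    then obtain i where "i \<in> K - S" "y i \<noteq> 0" by auto
    hence "(\<Prod>i\<in>K - S. of_bool (y i = 0)) = (0 :: real)"
      using K by (intro prod_zero) auto
    with False show ?thesis by simp
  next
    case True
    hence "(\<Prod>i\<in>K - S. of_bool (y i = 0)) = (\<Prod>i\<in>K - S. 1 :: real)"
      by (intro prod.cong) auto
    with True show ?thesis by simp
  qed
  finally show ?thesis by simp
qed

text \<open>Biorthogonality holds coordinate by coordinate. It provides the inverse of the matrix of
  tensor vectors.\<close>

lemma sum_dual_tensor_vec:
  assumes K: "finite K"
    and x: "x \<in> (\<Pi>\<^sub>E i\<in>K. {..<n i})" and y: "y \<in> (\<Pi>\<^sub>E i\<in>K. {..<n i})"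
  shows "(\<Sum>z\<in>(\<Pi>\<^sub>E i\<in>K. {..<n i}). (\<Prod>i\<in>K. dual_vec (n i) (x i) (z i)) * tensor_vec K y z) =
           of_bool (x = y)"
proof -
  have "(\<Sum>z\<in>(\<Pi>\<^sub>E i\<in>K. {..<n i}). (\<Prod>i\<in>K. dual_vec (n i) (x i) (z i)) * tensor_vec K y z) =
      (\<Sum>z\<in>(\<Pi>\<^sub>E i\<in>K. {..<n i}). \<Prod>i\<in>K. dual_vec (n i) (x i) (z i) * basis_vec (y i) (z i))"
    by (simp only: tensor_vec_def prod.distrib)
  also have "\<dots> = (\<Prod>i\<in>K. \<Sum>a<n i. dual_vec (n i) (x i) a * basis_vec (y i) a)"
    using K by (intro prod_sum_PiE[symmetric]) auto
  also have "\<dots> = (\<Prod>i\<in>K. of_bool (x i = y i))"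
    using x y by (intro prod.cong refl sum_dual_basis_vec) auto
  also have "\<dots> = of_bool (x = y)"
  proof (cases "x = y")
    case False
    then obtain i where "i \<in> K" "x i \<noteq> y i"
      using PiE_ext[OF x y] by blast
    hence "(\<Prod>i\<in>K. of_bool (x i = y i)) = (0 :: real)"
      using K by (intro prod_zero) auto
    with False show ?thesis by simp
  qed simp
  finally show ?thesis .
qed

lemma eigenvalue_count_agreement:
  fixes e :: "nat \<Rightarrow> 'i \<Rightarrow> nat"
  assumes K: "finite K" and S: "\<And>c S. (c, S) \<in> set cs \<Longrightarrow> S \<subseteq> K"
    and e: "bij_betw e {..<N} (\<Pi>\<^sub>E i\<in>K. {..<n i})"
  shows "eigenvalue_count
           (mat N N (\<lambda>(i, j). real_of_int (agreement_weight cs {k\<in>K. e i k = e j k}))) p =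
         card {y \<in> (\<Pi>\<^sub>E i\<in>K. {..<n i}).
           p (real_of_int (agreement_eigenvalue K n cs {i\<in>K. y i \<noteq> 0}))}"
proof -
  define X where "X = (\<Pi>\<^sub>E i\<in>K. {..<n i})"
  define A where
    "A = mat N N (\<lambda>(i, j). real_of_int (agreement_weight cs {k\<in>K. e i k = e j k}))"
  define P where "P = mat N N (\<lambda>(i, j). tensor_vec K (e j) (e i))"
  define Q where "Q = mat N N (\<lambda>(i, j). \<Prod>k\<in>K. dual_vec (n k) (e i k) (e j k))"
  define d where "d j = real_of_int (agreement_eigenvalue K n cs {k\<in>K. e j k \<noteq> 0})" for j
  have bij: "bij_betw e {..<N} X" using e by (simp add: X_def)
  have eX: "e i \<in> X" if "i < N" for i
    using that bij by (auto simp: bij_betw_def)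
  have sum_e: "(\<Sum>i = 0..<N. f (e i)) = sum f X" for f :: "_ \<Rightarrow> real"
    using sum.reindex_bij_betw[OF bij, of f] by (simp add: atLeast0LessThan)
  have weight: "real_of_int (agreement_weight cs {k\<in>K. x k = z k}) =
      (\<Sum>(c, S)\<leftarrow>cs. real_of_int c * of_bool (\<forall>k\<in>S. x k = z k))" for x z :: "'i \<Rightarrow> nat"
    using S unfolding agreement_weight_def
  proof (induction cs)
    case (Cons a cs)
    obtain c S where a: "a = (c, S)" by fastforce
    have "S \<subseteq> {k\<in>K. x k = z k} \<longleftrightarrow> (\<forall>k\<in>S. x k = z k)"
      using Cons.prems[of c S] by (auto simp: a)
    moreover have "real_of_int (\<Sum>(c, S)\<leftarrow>cs. c * of_bool (S \<subseteq> {k\<in>K. x k = z k})) =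
        (\<Sum>(c, S)\<leftarrow>cs. real_of_int c * of_bool (\<forall>k\<in>S. x k = z k))"
      by (rule Cons.IH) (use Cons.prems in auto)
    ultimately show ?case by (simp add: a)
  qed simp
  \<comment> \<open>The eigenvectors do not depend on the terms of \<open>cs\<close>, so the
    eigenvalues of the single terms add up.\<close>
  have eigen: "(\<Sum>z\<in>X. real_of_int (agreement_weight cs {k\<in>K. x k = z k}) * tensor_vec K y z) =
      real_of_int (agreement_eigenvalue K n cs {k\<in>K. y k \<noteq> 0}) * tensor_vec K y x"
    if "x \<in> X" "y \<in> X" for x y
    using S unfolding weight agreement_eigenvalue_def
  proof (induction cs)
    case (Cons a cs)
    obtain c S where a: "a = (c, S)" by fastforce
    have SK: "S \<subseteq> K" using Cons.prems[of c S] by (simp add: a)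
    have "(\<Sum>z\<in>X. (\<Sum>(c, S)\<leftarrow>a # cs. real_of_int c * of_bool (\<forall>k\<in>S. x k = z k)) * tensor_vec K y z) =
        real_of_int c * (\<Sum>z\<in>X. of_bool (\<forall>k\<in>S. x k = z k) * tensor_vec K y z) +
        (\<Sum>z\<in>X. (\<Sum>(c, S)\<leftarrow>cs. real_of_int c * of_bool (\<forall>k\<in>S. x k = z k)) * tensor_vec K y z)"
      by (simp add: a ring_distribs sum.distrib sum_distrib_left mult.assoc)
    also have "(\<Sum>z\<in>X. of_bool (\<forall>k\<in>S. x k = z k) * tensor_vec K y z) =
        of_bool ({k\<in>K. y k \<noteq> 0} \<subseteq> S) * (\<Prod>i\<in>K - S. real (n i)) * tensor_vec K y x"
      using sum_agreement_tensor_vec[OF K SK, of x n y] that by (simp add: X_def)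
    also have "(\<Sum>z\<in>X. (\<Sum>(c, S)\<leftarrow>cs. real_of_int c * of_bool (\<forall>k\<in>S. x k = z k)) * tensor_vec K y z) =
        real_of_int (\<Sum>(c, S)\<leftarrow>cs. c * of_bool ({k\<in>K. y k \<noteq> 0} \<subseteq> S) * (\<Prod>i\<in>K - S. int (n i)))
          * tensor_vec K y x"
      by (rule Cons.IH) (use Cons.prems in auto)
    finally show ?case
      by (simp add: a ring_distribs)
  qed simp
  have AP: "A * P = P * mat N N (\<lambda>(i, j). if i = j then d i else 0)"
  proof (rule eq_matI)
    fix i j assume "i < dim_row (P * mat N N (\<lambda>(i, j). if i = j then d i else 0))"
      "j < dim_col (P * mat N N (\<lambda>(i, j). if i = j then d i else 0))"
    hence ij: "i < N" "j < N" by (auto simp: P_def)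
    have "(A * P) $$ (i, j) = (\<Sum>k = 0..<N.
        real_of_int (agreement_weight cs {l\<in>K. e i l = e k l}) * tensor_vec K (e j) (e k))"
      using ij by (simp add: A_def P_def scalar_prod_def)
    also have "\<dots> = d j * tensor_vec K (e j) (e i)"
      using sum_e[of "\<lambda>z. real_of_int (agreement_weight cs {l\<in>K. e i l = z l}) * tensor_vec K (e j) z"]
        eigen[OF eX eX] ij by (simp add: d_def)
    also have "\<dots> = (P * mat N N (\<lambda>(i, j). if i = j then d i else 0)) $$ (i, j)"
      using ij
      by (simp add: P_def scalar_prod_def if_distrib[of "\<lambda>x. _ * x"] mult.commute cong: if_cong)
    finally show "(A * P) $$ (i, j) = (P * mat N N (\<lambda>(i, j). if i = j then d i else 0)) $$ (i, j)" .
  qed (auto simp: A_def P_def)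
  have QP: "Q * P = 1\<^sub>m N"
  proof (rule eq_matI)
    fix i j assume "i < dim_row (1\<^sub>m N)" "j < dim_col (1\<^sub>m N)"
    hence ij: "i < N" "j < N" by auto
    have "(Q * P) $$ (i, j) =
        (\<Sum>k = 0..<N. (\<Prod>l\<in>K. dual_vec (n l) (e i l) (e k l)) * tensor_vec K (e j) (e k))"
      using ij by (simp add: P_def Q_def scalar_prod_def)
    also have "\<dots> = of_bool (e i = e j)"
      using sum_e[of "\<lambda>z. (\<Prod>l\<in>K. dual_vec (n l) (e i l) (z l)) * tensor_vec K (e j) z"]
        sum_dual_tensor_vec[OF K, of "e i" n "e j"] eX ij by (simp add: X_def)
    also have "e i = e j \<longleftrightarrow> i = j"
      using bij ij by (auto simp: bij_betw_def inj_on_def)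
    finally show "(Q * P) $$ (i, j) = 1\<^sub>m N $$ (i, j)"
      using ij by simp
  qed (auto simp: P_def Q_def)
  have "eigenvalue_count A p = card {k\<in>{..<N}. p (d k)}"
    by (rule eigenvalue_count_eigenbasis[OF _ _ _ QP AP]) (auto simp: A_def P_def Q_def)
  also have "\<dots> = card (e ` {k\<in>{..<N}. p (d k)})"
    using bij by (intro card_image[symmetric]) (auto simp: bij_betw_def inj_on_def)
  also have "e ` {k\<in>{..<N}. p (d k)} =
      {y\<in>X. p (real_of_int (agreement_eigenvalue K n cs {i\<in>K. y i \<noteq> 0}))}"
    using bij by (auto simp: bij_betw_def d_def)
  finally show ?thesis by (simp add: A_def X_def)
qed

section \<open>Graphs on tuples with six coordinates\<close>

text \<open>
  A computer search for functions \<open>f\<close> of the agreement set with values in \<open>{0, 1}\<close> found these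
  Moebius coefficients. The sides are chosen so that every set with a negative coefficient has side
  product \<open>t\<^sup>3\<close>, whereas all six sides have product \<open>t\<^sup>7\<close>.
\<close>

definition signed_sets :: "(int \<times> nat set) list" where
  "signed_sets =
     [(1, {0}), (-1, {0,3}), (-1, {0,4}), (-1, {0,5}), (1, {0,3,4}),
      (1, {1,3}), (1, {2,4}), (1, {3,5}), (1, {4,5}),
      (-1, {1,2,3}), (-1, {1,2,4}), (1, {1,2,5}), (-1, {1,3,5}), (-1, {2,4,5}), (-1, {3,4,5}),
      (1, {0,1,2,3,4,5})]"

definition side :: "nat \<Rightarrow> nat \<Rightarrow> nat" where
  "side t i = (if i = 0 then t ^ 2 else t)"

definition tuples :: "nat \<Rightarrow> (nat \<Rightarrow> nat) set" where
  "tuples t = (\<Pi>\<^sub>E i\<in>{..<6}. {..<side t i})"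

abbreviation signed_eigenvalue :: "nat \<Rightarrow> nat set \<Rightarrow> int" where
  "signed_eigenvalue t \<equiv> agreement_eigenvalue {..<6} (side t) signed_sets"

lemma lessThan_6: "{..<6} = {0, 1, 2, 3, 4, 5 :: nat}"
  by auto

text \<open>Checked over the 64 possible traces of \<open>T\<close> on the six coordinates. The
  values 0 and 1 make the weight an adjacency indicator; the value 0 at full agreement excludes
  loops.\<close>

lemma agreement_weight_signed_sets:
  "agreement_weight signed_sets T \<in> {0, 1}"
  "agreement_weight signed_sets {..<6} = 0"
proof -
  show "agreement_weight signed_sets T \<in> {0, 1}"
    by (cases "0 \<in> T"; cases "1 \<in> T"; cases "2 \<in> T"; cases "3 \<in> T"; cases "4 \<in> T"; cases "5 \<in> T")
       (simp_all add: agreement_weight_def signed_sets_def)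
  show "agreement_weight signed_sets {..<6} = 0"
    by (simp add: agreement_weight_def signed_sets_def)
qed

text \<open>The exponent for \<open>S\<close> is 7 minus the number of elements of \<open>S\<close>,
  where coordinate 0 counts twice because its side is t^2.\<close>

lemma signed_eigenvalue_eq:
  "signed_eigenvalue t U =
     of_bool (U \<subseteq> {0}) * int t ^ 5 - of_bool (U \<subseteq> {0,3}) * int t ^ 4
     - of_bool (U \<subseteq> {0,4}) * int t ^ 4 - of_bool (U \<subseteq> {0,5}) * int t ^ 4
     + of_bool (U \<subseteq> {0,3,4}) * int t ^ 3
     + of_bool (U \<subseteq> {1,3}) * int t ^ 5 + of_bool (U \<subseteq> {2,4}) * int t ^ 5
     + of_bool (U \<subseteq> {3,5}) * int t ^ 5 + of_bool (U \<subseteq> {4,5}) * int t ^ 5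
     - of_bool (U \<subseteq> {1,2,3}) * int t ^ 4 - of_bool (U \<subseteq> {1,2,4}) * int t ^ 4
     + of_bool (U \<subseteq> {1,2,5}) * int t ^ 4 - of_bool (U \<subseteq> {1,3,5}) * int t ^ 4
     - of_bool (U \<subseteq> {2,4,5}) * int t ^ 4 - of_bool (U \<subseteq> {3,4,5}) * int t ^ 4
     + of_bool (U \<subseteq> {..<6})"
  unfolding agreement_eigenvalue_def signed_sets_def lessThan_6
  by (simp add: side_def insert_Diff_if power2_eq_square eval_nat_numeral mult_ac)

lemma signed_eigenvalue_nonzero:
  assumes "U \<subseteq> {..<6}" "t \<ge> 2"
  shows "signed_eigenvalue t U \<noteq> 0"
proof
  assume *: "signed_eigenvalue t U = 0"
  have full: "of_bool (U \<subseteq> {..<6}) = (1 :: int)"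
    using assms(1) by simp
  \<comment> \<open>Only the full set contributes a term that is not a multiple of \<open>t\<close>.\<close>
  have "int t dvd signed_eigenvalue t U - 1"
    unfolding signed_eigenvalue_eq full add_diff_cancel_right'
    by (intro dvd_add dvd_diff dvd_mult dvd_power) simp_all
  hence "int t dvd 1" by (simp add: *)
  thus False using assms(2) by simp
qed

lemma signed_eigenvalue_neg_imp:
  assumes "signed_eigenvalue t U < 0"
  shows "\<exists>S. (-1, S) \<in> set signed_sets \<and> U \<subseteq> S"
proof (rule ccontr)
  assume "\<not> ?thesis"
  hence neg: "of_bool (U \<subseteq> S) = (0 :: int)" if "(-1, S) \<in> set signed_sets" for S
    using that by simp
  have "of_bool (U \<subseteq> {0,3}) = (0 :: int)" "of_bool (U \<subseteq> {0,4}) = (0 :: int)"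
    "of_bool (U \<subseteq> {0,5}) = (0 :: int)" "of_bool (U \<subseteq> {1,2,3}) = (0 :: int)"
    "of_bool (U \<subseteq> {1,2,4}) = (0 :: int)" "of_bool (U \<subseteq> {1,3,5}) = (0 :: int)"
    "of_bool (U \<subseteq> {2,4,5}) = (0 :: int)" "of_bool (U \<subseteq> {3,4,5}) = (0 :: int)"
    by (rule neg, simp add: signed_sets_def)+
  hence "signed_eigenvalue t U \<ge> 0"
    unfolding signed_eigenvalue_eq
    by (simp only: mult_zero_left diff_zero)
       (intro add_nonneg_nonneg mult_nonneg_nonneg zero_le_power; simp)
  with assms show False by simp
qed

section \<open>Counting the negative eigenvalues\<close>

lemma card_tuples: "card (tuples t) = t ^ 7"
  unfolding tuples_def lessThan_6
  by (simp add: card_PiE side_def power2_eq_square eval_nat_numeral mult_ac)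

lemma finite_tuples: "finite (tuples t)"
  by (simp add: tuples_def finite_PiE)

text \<open>The support of such a tuple lies in one of the eight sets of coefficient -1, and the
  tuples supported in one such set form a box of size t^3.\<close>

lemma card_negative_le:
  assumes "t > 0"
  shows "card {y\<in>tuples t. signed_eigenvalue t {i\<in>{..<6}. y i \<noteq> 0} < 0} \<le> 8 * t ^ 3"
proof -
  define \<N> where "\<N> = {{0,3}, {0,4}, {0,5}, {1,2,3}, {1,2,4}, {1,3,5}, {2,4,5}, {3,4,5 :: nat}}"
  define Y where "Y S = {y\<in>tuples t. {i\<in>{..<6}. y i \<noteq> 0} \<subseteq> S}" for S
  \<comment> \<open>Positivity of \<open>t\<close> ensures that 0 belongs to every side, so the
    support condition does cut out a box.\<close>
  have mem_if: "a \<in> (if i \<in> S then {..<side t i} else {0}) \<longleftrightarrow> a < side t i \<and> (a \<noteq> 0 \<longrightarrow> i \<in> S)"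
    for a i S
    using assms by (auto simp: side_def)
  have cardY: "card (Y S) = t ^ 3" if "S \<in> \<N>" for S
  proof -
    have "Y S = (\<Pi>\<^sub>E i\<in>{..<6}. if i \<in> S then {..<side t i} else {0})"
      unfolding Y_def tuples_def set_eq_iff mem_Collect_eq PiE_iff mem_if subset_iff by blast
    hence "card (Y S) = (\<Prod>i<6. if i \<in> S then side t i else 1)"
      by (simp add: card_PiE if_distrib[of card] cong: if_cong prod.cong)
    also have "\<dots> = t ^ 3"
      using that unfolding \<N>_def lessThan_6
      by (auto simp: side_def power2_eq_square eval_nat_numeral)
    finally show ?thesis .
  qed
  have "{y\<in>tuples t. signed_eigenvalue t {i\<in>{..<6}. y i \<noteq> 0} < 0} \<subseteq> (\<Union>S\<in>\<N>. Y S)"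
  proof
    fix y assume y: "y \<in> {y\<in>tuples t. signed_eigenvalue t {i\<in>{..<6}. y i \<noteq> 0} < 0}"
    then obtain S where S: "(-1, S) \<in> set signed_sets" "{i\<in>{..<6}. y i \<noteq> 0} \<subseteq> S"
      using signed_eigenvalue_neg_imp[of t "{i\<in>{..<6}. y i \<noteq> 0}"] by auto
    have "S \<in> \<N>" using S(1) by (auto simp: signed_sets_def \<N>_def)
    with S y show "y \<in> (\<Union>S\<in>\<N>. Y S)" by (auto simp: Y_def)
  qed
  hence "card {y\<in>tuples t. signed_eigenvalue t {i\<in>{..<6}. y i \<noteq> 0} < 0} \<le> card (\<Union>S\<in>\<N>. Y S)"
    by (intro card_mono finite_subset[OF _ finite_tuples[of t]]) (auto simp: Y_def)
  also have "\<dots> \<le> (\<Sum>S\<in>\<N>. card (Y S))"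
    by (rule card_UN_le) (simp add: \<N>_def)
  also have "\<dots> = card \<N> * t ^ 3"
    using cardY by simp
  also have "card \<N> \<le> 8"
    unfolding \<N>_def by (intro card_insert_le_m1) simp_all
  finally show ?thesis by simp
qed

text \<open>Among the signed sets only {1,2,3} and the full set contain {1,2,3}, so this support has
  eigenvalue 1 - t^4. Exactly (t - 1)^3 tuples have it.\<close>

lemma card_negative_ge:
  assumes "t \<ge> 2"
  shows "(t - 1) ^ 3 \<le> card {y\<in>tuples t. signed_eigenvalue t {i\<in>{..<6}. y i \<noteq> 0} < 0}"
proof -
  define Y where "Y = (\<Pi>\<^sub>E i\<in>{..<6}. if i \<in> {1,2,3::nat} then {1..<t} else {0})"
  have "1 < int t ^ 4"
    using assms by simp
  hence "signed_eigenvalue t {1,2,3} < 0"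
    by (simp add: signed_eigenvalue_eq)
  moreover have "{i\<in>{..<6}. y i \<noteq> 0} = {1,2,3}" if "y \<in> Y" for y
  proof -
    have "y i \<noteq> 0 \<longleftrightarrow> i \<in> {1,2,3}" if "i < 6" for i
      using PiE_mem[OF \<open>y \<in> Y\<close>[unfolded Y_def], of i] that
      by (cases "i \<in> {1,2,3}") simp_all
    thus ?thesis by auto
  qed
  moreover have "Y \<subseteq> tuples t"
    unfolding Y_def tuples_def using assms by (intro PiE_mono) (auto simp: side_def)
  ultimately have "Y \<subseteq> {y\<in>tuples t. signed_eigenvalue t {i\<in>{..<6}. y i \<noteq> 0} < 0}"
    by auto
  hence "card Y \<le> card {y\<in>tuples t. signed_eigenvalue t {i\<in>{..<6}. y i \<noteq> 0} < 0}"
    by (rule card_mono[rotated]) (simp add: finite_tuples)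
  moreover have "card Y = (t - 1) ^ 3"
    unfolding Y_def lessThan_6 by (simp add: card_PiE eval_nat_numeral)
  ultimately show ?thesis by simp
qed

section \<open>The graph for each side length\<close>

lemma exists_graph:
  assumes t: "t \<ge> 2"
  shows "\<exists>G :: nat pair_pre_digraph. pair_graph G \<and> nonsingular_graph G \<and>
           (t - 1) ^ 3 \<le> n_neg G \<and> n_neg G \<le> 8 * t ^ 3 \<and> n_pos G + n_neg G = t ^ 7"
proof -
  define ev where "ev y = signed_eigenvalue t {i\<in>{..<6}. y i \<noteq> 0}" for y :: "nat \<Rightarrow> nat"
  obtain e where e: "bij_betw e {..<t ^ 7} (tuples t)"
    using ex_bij_betw_nat_finite[OF finite_tuples[of t]]
    by (auto simp: card_tuples atLeast0LessThan)
  define w where "w i j = agreement_weight signed_sets {k\<in>{..<6}. e i k = e j k}" for i j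
  \<comment> \<open>The vertices are the positions of the tuples in the enumeration
    \<open>e\<close>, so the sorted vertex list is an initial segment of the naturals and matrix
    indices coincide with vertices.\<close>
  define G where "G = \<lparr>pverts = {..<t ^ 7}, parcs = {(i, j). i < t ^ 7 \<and> j < t ^ 7 \<and> w i j = 1}\<rparr>"
  have w01: "w i j = 0 \<or> w i j = 1" for i j
    using agreement_weight_signed_sets(1) by (auto simp: w_def)
  have w_sym: "w i j = w j i" for i j
    by (simp add: w_def eq_commute)
  have w_refl: "w i i = 0" for i
  proof -
    have "{k\<in>{..<6}. e i k = e i k} = {..<6}" by auto
    thus ?thesis using agreement_weight_signed_sets(2) by (simp only: w_def)
  qed
  have "pair_graph G"
  proof unfold_locales
    show "finite (parcs G)"
      by (rule finite_subset[of _ "{..<t ^ 7} \<times> {..<t ^ 7}"]) (auto simp: G_def)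
    show "symmetric (with_proj G)"
      by (auto simp: symmetric_def arcs_ends_def arc_to_ends_def sym_def G_def w_sym)
  qed (auto simp: G_def w_refl)
  have verts: "sorted_list_of_set (pverts G) = [0..<t ^ 7]"
    by (simp add: G_def lessThan_atLeast0)
  have adj: "adjacency_matrix G = mat (t ^ 7) (t ^ 7)
      (\<lambda>(i, j). real_of_int (agreement_weight signed_sets {k\<in>{..<6}. e i k = e j k}))"
    unfolding adjacency_matrix_def Let_def verts w_def[symmetric]
  proof (rule eq_matI, goal_cases)
    case (1 i j)
    thus ?case using w01[of i j] by (auto simp: G_def)
  qed simp_all
  have count: "eigenvalue_count (adjacency_matrix G) p = card {y\<in>tuples t. p (real_of_int (ev y))}" for p
    unfolding adj ev_def tuples_def
    by (rule eigenvalue_count_agreement)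
       (use e in \<open>auto simp: tuples_def signed_sets_def\<close>)
  have ev_nz: "ev y \<noteq> 0" for y
    unfolding ev_def using t by (intro signed_eigenvalue_nonzero) auto
  have "nonsingular_graph G"
    unfolding nonsingular_graph_iff n_zero_def count using ev_nz by simp
  moreover have neg: "n_neg G = card {y\<in>tuples t. ev y < 0}"
    unfolding n_neg_def count by simp
  moreover have "n_pos G + n_neg G = t ^ 7"
  proof -
    have "n_pos G + n_neg G = card ({y\<in>tuples t. ev y > 0} \<union> {y\<in>tuples t. ev y < 0})"
      unfolding neg n_pos_def count
      by (subst card_Un_disjoint) (auto simp: finite_tuples)
    also have "{y\<in>tuples t. ev y > 0} \<union> {y\<in>tuples t. ev y < 0} = tuples t"
      using ev_nz by (auto simp: neq_iff)
    finally show ?thesis by (simp add: card_tuples)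
  qed
  ultimately show ?thesis
    using \<open>pair_graph G\<close> card_negative_le[of t] card_negative_ge[OF t] t
    by (auto simp: ev_def[abs_def])
qed

section \<open>Asymptotic comparison\<close>

theorem theorem1p5:
  shows "\<exists>G :: nat \<Rightarrow> nat pair_pre_digraph.
           (\<forall>m. pair_graph (G m) \<and> nonsingular_graph (G m)) \<and>
           filterlim (\<lambda>m. n_neg (G m)) at_top at_top \<and>
           (\<lambda>m. real (n_pos (G m))) \<in> \<Theta>(\<lambda>m. real (n_neg (G m)) powr (7 / 3))"
proof -
  \<comment> \<open>The shift t = m + 2 meets the condition t \<ge> 2 for every
    \<open>m\<close>.\<close>
  have "\<forall>m. \<exists>G :: nat pair_pre_digraph. pair_graph G \<and> nonsingular_graph G \<and>
      (m + 1) ^ 3 \<le> n_neg G \<and> n_neg G \<le> 8 * (m + 2) ^ 3 \<and> n_pos G + n_neg G = (m + 2) ^ 7"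
    using exists_graph[of "m + 2" for m] by simp
  then obtain G :: "nat \<Rightarrow> nat pair_pre_digraph"
    where G: "\<And>m. pair_graph (G m)" "\<And>m. nonsingular_graph (G m)"
      and lower: "\<And>m. (m + 1) ^ 3 \<le> n_neg (G m)"
      and upper: "\<And>m. n_neg (G m) \<le> 8 * (m + 2) ^ 3"
      and total: "\<And>m. n_pos (G m) + n_neg (G m) = (m + 2) ^ 7"
    by metis
  have "filterlim (\<lambda>m. n_neg (G m)) at_top at_top"
  proof (rule filterlim_at_top_mono[OF filterlim_ident], intro always_eventually allI)
    fix m :: nat
    have "m \<le> (m + 1) ^ 3"
      using self_le_power[of "m + 1" 3] by simp
    thus "m \<le> n_neg (G m)" using lower[of m] by linarith
  qed
  moreover have "(\<lambda>m. real (n_pos (G m))) \<in> \<Theta>(\<lambda>m. real (n_neg (G m)) powr (7 / 3))"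
  proof (rule bigthetaI')
    \<comment> \<open>Here 128 is 8 to the power 7/3. It arises from both bounds t^3/8 \<le>
      \<open>n_neg\<close> \<le> 8 t^3; the further factor 2 in 256 comes from \<open>n_pos\<close>
      \<ge> t^7/2.\<close>
    show "0 < (1 / 256 :: real)" "0 < (128 :: real)" by simp_all
    show "\<forall>\<^sub>F m in at_top.
        1 / 256 * norm (real (n_neg (G m)) powr (7 / 3)) \<le> norm (real (n_pos (G m))) \<and>
        norm (real (n_pos (G m))) \<le> 128 * norm (real (n_neg (G m)) powr (7 / 3))"
    proof (intro always_eventually allI conjI)
      fix m
      define t where "t = real (m + 2)"
      have t: "t \<ge> 2" by (simp add: t_def)
      have cube: "(c * t ^ 3) powr (7 / 3) = c powr (7 / 3) * t ^ 7" if "c \<ge> 0" for c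
      proof -
        have "(t ^ 3) powr (7 / 3) = (t powr 3) powr (7 / 3)"
          using t by simp
        also have "\<dots> = t powr 7"
          unfolding powr_powr by simp
        also have "\<dots> = t ^ 7"
          using t by simp
        finally show ?thesis using that t by (simp add: powr_mult)
      qed
      have eight: "(8 :: real) powr (7 / 3) = 128"
      proof -
        have "(8 :: real) = 2 powr 3" by simp
        hence "(8 :: real) powr (7 / 3) = 2 powr (3 * (7 / 3))"
          by (simp only: powr_powr)
        thus ?thesis by simp
      qed
      have eighth: "((1 / 8) * t ^ 3) powr (7 / 3) = t ^ 7 / 128"
        by (subst cube) (simp_all add: powr_divide eight)
      have tot: "real (n_pos (G m)) + real (n_neg (G m)) = t ^ 7"
        unfolding t_def using total[of m] by (metis of_nat_add of_nat_power)
      have up: "real (n_neg (G m)) \<le> 8 * t ^ 3"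
      proof -
        have "real (n_neg (G m)) \<le> real (8 * (m + 2) ^ 3)"
          using upper[of m] by (simp only: of_nat_le_iff)
        thus ?thesis by (simp only: t_def of_nat_mult of_nat_power of_nat_numeral)
      qed
      have "real (n_neg (G m)) powr (7 / 3) \<le> (8 * t ^ 3) powr (7 / 3)"
        using up by (intro powr_mono2) simp_all
      hence "real (n_neg (G m)) powr (7 / 3) \<le> 128 * t ^ 7"
        by (simp add: cube eight)
      \<comment> \<open>Hence at most half of the eigenvalues are negative, which bounds
        \<open>n_pos\<close> from below.\<close>
      moreover have "8 * t ^ 3 \<le> t ^ 7 / 2"
      proof -
        have "16 \<le> t ^ 4" using power_mono[OF t, of 4] by simp
        hence "16 * t ^ 3 \<le> t ^ 4 * t ^ 3" using t by (intro mult_right_mono) simp_all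
        thus ?thesis by (simp flip: power_add)
      qed
      ultimately show "1 / 256 * norm (real (n_neg (G m)) powr (7 / 3)) \<le> norm (real (n_pos (G m)))"
        using tot up by simp
      \<comment> \<open>Since t \<ge> 2, t/2 \<le> t - 1; this turns the lower bound on
        \<open>n_neg\<close> into a multiple of t^3.\<close>
      have "(t / 2) ^ 3 \<le> (t - 1) ^ 3"
        using t by (intro power_mono) simp_all
      also have "(t - 1) ^ 3 = real ((m + 1) ^ 3)"
        by (simp add: t_def add.commute)
      also have "\<dots> \<le> real (n_neg (G m))"
        using lower[of m] by (simp only: of_nat_le_iff)
      finally have "(1 / 8) * t ^ 3 \<le> real (n_neg (G m))"
        by (simp add: power_divide)
      hence "((1 / 8) * t ^ 3) powr (7 / 3) \<le> real (n_neg (G m)) powr (7 / 3)"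
        using t by (intro powr_mono2) simp_all
      hence "t ^ 7 / 128 \<le> real (n_neg (G m)) powr (7 / 3)"
        by (simp only: eighth)
      thus "norm (real (n_pos (G m))) \<le> 128 * norm (real (n_neg (G m)) powr (7 / 3))"
        using tot by simp
    qed
  qed
  ultimately show ?thesis using G by blast
qed

end
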